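(* Let $(\Omega,\mathcal{F},(\mathcal{F}_r)_{r\in\mathbb{R}},\mathbb{P})$ be a filtered probability space and let $(X_r)_{r\in\mathbb{R}}$ be a right-continuous integrable sub-martingale on it. 1. If $\sup_{r\in\mathbb{R}_+}\mathbb{E}[|X_r|]<+\infty$, then there exists an integrable random variable $X$ such that $\lim_{r\to+\infty}X_r=X$ almost surely. 2. The limit $\lim_{r\to-\infty}X_r$ exists almost surely in $[-\infty,+\infty[$.
   Context: $\mathbb{R}_+=[0,+\infty[$. The filtration $(\mathcal{F}_r)_{r\in\mathbb{R}}$ is a non-decreasing family of sub-$\sigma$-algebras of $\mathcal{F}$ indexed by $\mathbb{R}$ (no completeness or right-continuity of the filtration is assumed). A process $(X_r)_{r\in\mathbb{R}}$ is an integrable sub-martingale if it is real-valued, adapted to $(\mathcal{F}_r)_{r\in\mathbb{R}}$, each $X_r$ is integrable, and $\mathbb{E}[X_t\mid\mathcal{F}_s]\geq X_s$ almost surely for all real $s\leq t$. "Right-continuous" means that the sample paths $r\mapsto X_r(\omega)$ are right-continuous. All limits in $r$ are taken along real $r$. *)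

theory Defs
  imports "HOL-Probability.Probability"
begin

text \<open>
  As usual in the library, a sub-\<open>\<sigma>\<close>-algebra of \<open>M\<close> is represented by a measure space of which
  only the underlying set and the measurable sets matter. The measure carried by \<open>F r\<close> is irrelevant.
\<close>

locale filtered_prob_space = prob_space M + filtration "space M" F
  for M :: "'a measure" and F :: "real \<Rightarrow> 'a measure" +
  assumes subalgebra_F: "\<And>r. subalgebra M (F r)"

definition integrable_submartingale ::
  "'a measure \<Rightarrow> (real \<Rightarrow> 'a measure) \<Rightarrow> (real \<Rightarrow> 'a \<Rightarrow> real) \<Rightarrow> bool" where
  "integrable_submartingale M F X \<longleftrightarrow>
     (\<forall>r. X r \<in> borel_measurable (F r)) \<and>
     (\<forall>r. integrable M (X r)) \<and>
     (\<forall>s t. s \<le> t \<longrightarrow> (AE \<omega> in M. X s \<omega> \<le> real_cond_exp M (F s) (X t) \<omega>))"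

definition right_continuous_process :: "'a measure \<Rightarrow> (real \<Rightarrow> 'a \<Rightarrow> real) \<Rightarrow> bool" where
  "right_continuous_process M X \<longleftrightarrow>
     (\<forall>\<omega>\<in>space M. \<forall>r. continuous (at_right r) (\<lambda>u. X u \<omega>))"

end

theory Submission
  imports Defs
begin

text \<open>
  Along a grid of mesh \<open>1 / n\<close> starting at \<open>-n\<close>, Doob's inequality bounds the expected number of
  upcrossings of \<open>[a, b]\<close> by the expectation of \<open>max 0 (X - a)\<close> at the last grid point, uniformly in
  \<open>n\<close>. By Fatou, almost surely these numbers do not tend to infinity. By right-continuity, every
  finite chain of strict upcrossings at real times is seen by all sufficiently fine grids, so a path
  that oscillates across \<open>[a, b]\<close> at \<open>+\<infinity>\<close> or \<open>-\<infinity>\<close> would make them tend to infinity. Hence limits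
  exist in the extended reals, and Fatou again excludes the forbidden infinite values.
\<close>

section \<open>Upcrossing counts of a real sequence\<close>

text \<open>A two-state automaton replacing the usual alternating hitting times: for
  \<open>a < b\<close>, a value at most \<open>a\<close> switches it on and a value at least
  \<open>b\<close> switches it off. The state at \<open>n\<close> depends only on
  \<open>x 0\<close>, ..., \<open>x n\<close>, so measurability is a plain induction, without
  stopping times.\<close>

primrec climbing :: "real \<Rightarrow> real \<Rightarrow> (nat \<Rightarrow> real) \<Rightarrow> nat \<Rightarrow> bool" where
  "climbing a b x 0 \<longleftrightarrow> x 0 \<le> a"
| "climbing a b x (Suc n) \<longleftrightarrow> (if climbing a b x n then x (Suc n) < b else x (Suc n) \<le> a)"

primrec upcrossings :: "real \<Rightarrow> real \<Rightarrow> (nat \<Rightarrow> real) \<Rightarrow> nat \<Rightarrow> nat" where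
  "upcrossings a b x 0 = 0"
| "upcrossings a b x (Suc n) =
     upcrossings a b x n + of_bool (climbing a b x n \<and> b \<le> x (Suc n))"

lemma mono_upcrossings: "mono (upcrossings a b x)"
  by (rule incseq_SucI) simp

lemma upcrossings_le: "upcrossings a b x n \<le> n"
  by (induction n) (auto simp: of_bool_def)

lemma climbing_if_le: "x n \<le> a \<Longrightarrow> a < b \<Longrightarrow> climbing a b x n"
  by (cases n) auto

lemma not_climbing_if_ge: "b \<le> x n \<Longrightarrow> a < b \<Longrightarrow> \<not> climbing a b x n"
  by (cases n) auto

text \<open>At \<open>i\<close> the automaton is climbing and at \<open>j\<close> it is not. It
  leaves the climbing state only by completing an upcrossing, so the count rises in between.\<close>

lemma upcrossings_increase:
  assumes "a < b" "x i \<le> a" "b \<le> x j" "i < j"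
  shows "Suc (upcrossings a b x i) \<le> upcrossings a b x j"
proof -
  have "climbing a b x (i + k) \<or> Suc (upcrossings a b x i) \<le> upcrossings a b x (i + k)" for k
  proof (induction k)
    case 0
    then show ?case using climbing_if_le assms by auto
  next
    case (Suc k)
    have "upcrossings a b x i \<le> upcrossings a b x (i + k)"
      by (rule monoD[OF mono_upcrossings]) simp
    with Suc show ?case by auto
  qed
  from this[of "j - i"] show ?thesis
    using not_climbing_if_ge[of b x j a] assms by auto
qed

section \<open>Grids of times exhausting the real line\<close>

text \<open>For positive \<open>n\<close> the value is \<open>i / n - n\<close>. For
  \<open>n = 0\<close> division by zero makes the grid constantly 0, which is still monotone, so the
  bounds below can be uniform in all \<open>n\<close>.\<close>

definition grid :: "nat \<Rightarrow> nat \<Rightarrow> real" where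
  "grid n i = (real i - (real n)\<^sup>2) / real n"

text \<open>The index of the first grid point strictly to the right of \<open>t\<close>, once \<open>n\<close> is so large that the
  argument of \<open>nat\<close> is nonnegative. Being strictly to the right lets right-continuity apply.\<close>
definition grid_index :: "nat \<Rightarrow> real \<Rightarrow> nat" where
  "grid_index n t = nat (\<lfloor>t * real n\<rfloor> + 1 + (int n)\<^sup>2)"

lemma mono_grid: "mono (grid n)"
  by (rule monoI) (simp add: grid_def divide_right_mono)

lemma mono_grid_index: "mono (grid_index n)"
  unfolding grid_index_def
  by (rule monoI) (intro nat_mono add_right_mono floor_mono mult_right_mono, auto)

text \<open>Eventually the grid point is \<open>(\<lfloor>t * n\<rfloor> + 1) / n\<close>, which is
  greater than \<open>t\<close> and at most \<open>t + 1 / n\<close>.\<close>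

lemma filterlim_grid_grid_index:
  "filterlim (\<lambda>n. grid n (grid_index n t)) (at_right t) sequentially"
proof -
  \<comment> \<open>For \<open>n \<ge> N\<close> the grid starts at or to the left of
    \<open>t\<close>, so the \<open>nat\<close> in \<open>grid_index\<close> truncates
    nothing.\<close>
  obtain N where N: "\<bar>t\<bar> \<le> real N"
    using real_arch_simple by blast
  have eq: "grid n (grid_index n t) = (of_int \<lfloor>t * real n\<rfloor> + 1) / real n" if "N \<le> n" for n
  proof -
    have "- real n \<le> t" using N that by linarith
    then have "- real n * real n \<le> t * real n"
      by (intro mult_right_mono) auto
    then have "- (int n)\<^sup>2 \<le> \<lfloor>t * real n\<rfloor>"
      by (simp add: le_floor_iff power2_eq_square)
    then have "real (grid_index n t) = of_int (\<lfloor>t * real n\<rfloor> + 1 + (int n)\<^sup>2)"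
      unfolding grid_index_def by (subst of_nat_nat) auto
    then show ?thesis by (simp add: grid_def)
  qed
  have gt: "t < grid n (grid_index n t)" if "max N 1 \<le> n" for n
    using that by (simp add: eq less_divide_eq)
  have le: "grid n (grid_index n t) \<le> t + inverse (real n)" if "max N 1 \<le> n" for n
    using that of_int_floor_le[of "t * real n"] by (simp add: eq field_simps)
  have "(\<lambda>n. grid n (grid_index n t)) \<longlonglongrightarrow> t"
  proof (rule tendsto_sandwich)
    show "eventually (\<lambda>n. t \<le> grid n (grid_index n t)) sequentially"
      unfolding eventually_sequentially using gt less_imp_le by blast
    show "eventually (\<lambda>n. grid n (grid_index n t) \<le> t + inverse (real n)) sequentially"
      unfolding eventually_sequentially using le by blast
    show "(\<lambda>n. t + inverse (real n)) \<longlonglongrightarrow> t"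
      using tendsto_add[OF tendsto_const lim_inverse_n, of t] by simp
  qed simp
  moreover have "eventually (\<lambda>n. grid n (grid_index n t) \<in> {t<..}) sequentially"
    unfolding eventually_sequentially greaterThan_iff using gt by blast
  ultimately show ?thesis
    by (auto simp: filterlim_at elim: eventually_mono)
qed

text \<open>Locates the last grid point in both applications: for \<open>m = n\<close> it is
  nonnegative, for \<open>m = 0\<close> it is at most 1.\<close>

lemma grid_grid_index_nat: "grid n (grid_index n (real m)) = (if n = 0 then 0 else m + 1 / real n)"
proof (cases "n = 0")
  case False
  have "real (grid_index n (real m)) = real m * real n + 1 + (real n)\<^sup>2"
    unfolding grid_index_def of_nat_mult[symmetric] floor_of_nat
    by (subst of_nat_nat) auto
  then show ?thesis using False by (simp add: grid_def field_simps)
qed (simp add: grid_def)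

section \<open>Oscillating right-continuous paths\<close>

context
  fixes f :: "real \<Rightarrow> real"
  assumes right_cont: "\<And>r. continuous (at_right r) f"
begin

lemma tendsto_grid: "(\<lambda>n. f (grid n (grid_index n t))) \<longlonglongrightarrow> f t"
  using right_cont[of t] filterlim_grid_grid_index[of t]
  by (auto simp: continuous_within intro: filterlim_compose)

text \<open>The two grid points converge to \<open>s\<close> and \<open>t\<close>, hence end up on
  different sides of the midpoint; monotonicity of the grid then orders their indices.\<close>

lemma eventually_grid_index_less:
  assumes "s < t"
  shows "eventually (\<lambda>n. grid_index n s < grid_index n t) sequentially"
proof -
  define m where "m = (s + t) / 2"
  have lim: "(\<lambda>n. grid n (grid_index n u)) \<longlonglongrightarrow> u" for u
    using filterlim_grid_grid_index[of u] by (simp add: filterlim_at)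
  have "eventually (\<lambda>n. grid n (grid_index n s) < m) sequentially"
       "eventually (\<lambda>n. m < grid n (grid_index n t)) sequentially"
    by (rule order_tendstoD[OF lim], use assms in \<open>simp add: m_def\<close>)+
  then show ?thesis
    by eventually_elim (meson leD le_less_linear monoD[OF mono_grid] order.strict_trans order.strict_trans2)
qed

text \<open>The strict inequalities at \<open>s\<close> and \<open>t\<close> are open conditions, so
  right-continuity carries them over to the nearby grid points.\<close>

lemma eventually_upcrossings_increase:
  assumes "a < b" "s < t" "f s < a" "b < f t"
  shows "eventually (\<lambda>n. Suc (upcrossings a b (\<lambda>i. f (grid n i)) (grid_index n s))
      \<le> upcrossings a b (\<lambda>i. f (grid n i)) (grid_index n t)) sequentially"
  using eventually_grid_index_less[OF assms(2)] order_tendstoD(2)[OF tendsto_grid assms(3)]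
    order_tendstoD(1)[OF tendsto_grid assms(4)]
  by eventually_elim (rule upcrossings_increase[OF assms(1)], auto)

text \<open>The induction appends a low time and then a high time after the previous
  \<open>t\<close>. Since \<open>t\<close> is chosen before \<open>n\<close>, each step combines
  only finitely many eventual statements.\<close>

lemma upcrossings_unbounded_at_top:
  assumes "a < b" "frequently (\<lambda>r. f r < a) at_top" "frequently (\<lambda>r. b < f r) at_top"
  shows "\<exists>t. eventually
    (\<lambda>n. k \<le> upcrossings a b (\<lambda>i. f (grid n i)) (grid_index n t)) sequentially"
proof (induction k)
  case (Suc k)
  then obtain u where u: "eventually
    (\<lambda>n. k \<le> upcrossings a b (\<lambda>i. f (grid n i)) (grid_index n u)) sequentially"
    by blast
  obtain s where s: "u \<le> s" "f s < a"
    using frequently_eventually_frequently[OF assms(2) eventually_ge_at_top[of u]]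
    by (auto dest!: frequently_ex)
  obtain t where t: "s < t" "b < f t"
    using frequently_eventually_frequently[OF assms(3) eventually_gt_at_top[of s]]
    by (auto dest!: frequently_ex)
  have "eventually (\<lambda>n. Suc k \<le> upcrossings a b (\<lambda>i. f (grid n i)) (grid_index n t)) sequentially"
    using u eventually_upcrossings_increase[OF assms(1) t(1) s(2) t(2)]
  proof eventually_elim
    case (elim n)
    have "upcrossings a b (\<lambda>i. f (grid n i)) (grid_index n u)
        \<le> upcrossings a b (\<lambda>i. f (grid n i)) (grid_index n s)"
      by (intro monoD[OF mono_upcrossings] monoD[OF mono_grid_index] s)
    with elim show ?case by linarith
  qed
  then show ?case by blast
qed simp

text \<open>Here the chain is extended to the left, so what grows is the count between
  \<open>t\<close> and 0. The sum expresses this difference without truncated subtraction.\<close>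

lemma upcrossings_unbounded_at_bot:
  assumes "a < b" "frequently (\<lambda>r. f r < a) at_bot" "frequently (\<lambda>r. b < f r) at_bot"
  shows "\<exists>t. eventually (\<lambda>n. upcrossings a b (\<lambda>i. f (grid n i)) (grid_index n t) + k
      \<le> upcrossings a b (\<lambda>i. f (grid n i)) (grid_index n 0)) sequentially"
proof (induction k)
  case 0
  show ?case by (rule exI[of _ 0]) simp
next
  case (Suc k)
  then obtain u where u: "eventually (\<lambda>n. upcrossings a b (\<lambda>i. f (grid n i)) (grid_index n u) + k
      \<le> upcrossings a b (\<lambda>i. f (grid n i)) (grid_index n 0)) sequentially"
    by blast
  obtain t where t: "t \<le> u" "b < f t"
    using frequently_eventually_frequently[OF assms(3) eventually_le_at_bot[of u]]
    by (auto dest!: frequently_ex)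
  obtain s where s: "s < t" "f s < a"
    using frequently_eventually_frequently[OF assms(2) eventually_gt_at_bot[of t]]
    by (auto dest!: frequently_ex)
  have "eventually (\<lambda>n. upcrossings a b (\<lambda>i. f (grid n i)) (grid_index n s) + Suc k
      \<le> upcrossings a b (\<lambda>i. f (grid n i)) (grid_index n 0)) sequentially"
    using u eventually_upcrossings_increase[OF assms(1) s(1) s(2) t(2)]
  proof eventually_elim
    case (elim n)
    have "upcrossings a b (\<lambda>i. f (grid n i)) (grid_index n t)
        \<le> upcrossings a b (\<lambda>i. f (grid n i)) (grid_index n u)"
      by (intro monoD[OF mono_upcrossings] monoD[OF mono_grid_index] t)
    with elim show ?case by linarith
  qed
  then show ?case by blast
qed

text \<open>The moving horizon \<open>real n\<close> eventually passes the fixed end time of any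
  chain, and counts are monotone in the index.\<close>

lemma filterlim_upcrossings_at_top:
  assumes "a < b" "frequently (\<lambda>r. f r < a) at_top" "frequently (\<lambda>r. b < f r) at_top"
  shows "filterlim (\<lambda>n. upcrossings a b (\<lambda>i. f (grid n i)) (grid_index n (real n)))
    at_top sequentially"
  unfolding filterlim_at_top
proof
  fix k
  obtain t where t: "eventually
    (\<lambda>n. k \<le> upcrossings a b (\<lambda>i. f (grid n i)) (grid_index n t)) sequentially"
    using upcrossings_unbounded_at_top[OF assms] by blast
  have "eventually (\<lambda>n. t \<le> real n) sequentially"
    using filterlim_real_sequentially by (simp add: filterlim_at_top)
  with t show "eventually
    (\<lambda>n. k \<le> upcrossings a b (\<lambda>i. f (grid n i)) (grid_index n (real n))) sequentially"
    by eventually_elim (meson monoD[OF mono_upcrossings] monoD[OF mono_grid_index] order_trans)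
qed

lemma filterlim_upcrossings_at_bot:
  assumes "a < b" "frequently (\<lambda>r. f r < a) at_bot" "frequently (\<lambda>r. b < f r) at_bot"
  shows "filterlim (\<lambda>n. upcrossings a b (\<lambda>i. f (grid n i)) (grid_index n 0)) at_top sequentially"
  unfolding filterlim_at_top
proof
  fix k
  obtain t where "eventually (\<lambda>n. upcrossings a b (\<lambda>i. f (grid n i)) (grid_index n t) + k
      \<le> upcrossings a b (\<lambda>i. f (grid n i)) (grid_index n 0)) sequentially"
    using upcrossings_unbounded_at_bot[OF assms] by blast
  then show "eventually
    (\<lambda>n. k \<le> upcrossings a b (\<lambda>i. f (grid n i)) (grid_index n 0)) sequentially"
    by eventually_elim simp
qed

end

section \<open>A convergence criterion and consequences of Fatou's lemma\<close>

text \<open>Without a limit, \<open>Liminf\<close> is strictly below \<open>Limsup\<close>, and the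
  path oscillates across any two rationals in between. Rational levels keep the number of
  exceptional null sets countable.\<close>

lemma ereal_convergent_if_no_oscillation:
  fixes f :: "'b \<Rightarrow> real"
  assumes "L \<noteq> bot"
    and "\<And>a b. a \<in> \<rat> \<Longrightarrow> b \<in> \<rat> \<Longrightarrow> a < b \<Longrightarrow>
      \<not> (frequently (\<lambda>r. f r < a) L \<and> frequently (\<lambda>r. b < f r) L)"
  shows "\<exists>l. ((\<lambda>r. ereal (f r)) \<longlongrightarrow> l) L"
proof (rule ccontr)
  assume nex: "\<not> ?thesis"
  let ?g = "\<lambda>r. ereal (f r)"
  have "Liminf L ?g < Limsup L ?g"
    using Liminf_le_Limsup[of L ?g] Liminf_eq_Limsup[of L ?g] assms(1) nex
    by (metis order_le_less)
  then obtain q where q: "Liminf L ?g < real_of_rat q" "real_of_rat q < Limsup L ?g"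
    using ereal_dense3 by blast
  then obtain p where p: "real_of_rat q < real_of_rat p" "real_of_rat p < Limsup L ?g"
    using ereal_dense3[of "ereal (real_of_rat q)"] by auto
  have "frequently (\<lambda>r. f r < real_of_rat q) L"
  proof (rule ccontr)
    assume "\<not> ?thesis"
    then have "eventually (\<lambda>r. ereal (real_of_rat q) \<le> ?g r) L"
      by (simp add: not_frequently not_less)
    then have "ereal (real_of_rat q) \<le> Liminf L ?g" by (rule Liminf_bounded)
    with q show False by simp
  qed
  moreover have "frequently (\<lambda>r. real_of_rat p < f r) L"
  proof (rule ccontr)
    assume "\<not> ?thesis"
    then have "eventually (\<lambda>r. ?g r \<le> ereal (real_of_rat p)) L"
      by (simp add: not_frequently not_less)
    then have "Limsup L ?g \<le> ereal (real_of_rat p)" by (rule Limsup_bounded)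
    with p show False by simp
  qed
  ultimately show False
    using assms(2)[of "real_of_rat q" "real_of_rat p"] p(1) by simp
qed

lemma nn_integral_liminf_le_bound:
  fixes Z :: "nat \<Rightarrow> 'a \<Rightarrow> real"
  assumes "\<And>n. integrable M (Z n)" "\<And>n \<omega>. 0 \<le> Z n \<omega>" "\<And>n. integral\<^sup>L M (Z n) \<le> C"
  shows "(\<integral>\<^sup>+\<omega>. liminf (\<lambda>n. ennreal (Z n \<omega>)) \<partial>M) \<le> ennreal C"
proof -
  have [measurable]: "Z n \<in> borel_measurable M" for n using assms(1) by auto
  have "(\<integral>\<^sup>+\<omega>. liminf (\<lambda>n. ennreal (Z n \<omega>)) \<partial>M) \<le> liminf (\<lambda>n. \<integral>\<^sup>+\<omega>. ennreal (Z n \<omega>) \<partial>M)"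
    by (rule nn_integral_liminf) simp
  also have "\<dots> \<le> liminf (\<lambda>n. ennreal C)"
    using assms by (intro Liminf_mono always_eventually allI) (simp add: nn_integral_eq_integral ennreal_leI)
  finally show ?thesis by (simp add: Liminf_const)
qed

text \<open>By Fatou the \<open>liminf\<close> has finite integral, so it is almost everywhere
  finite, while divergence would make it infinite.\<close>

lemma AE_not_filterlim_at_top:
  fixes Z :: "nat \<Rightarrow> 'a \<Rightarrow> real"
  assumes "\<And>n. integrable M (Z n)" "\<And>n \<omega>. 0 \<le> Z n \<omega>" "\<And>n. integral\<^sup>L M (Z n) \<le> C"
  shows "AE \<omega> in M. \<not> filterlim (\<lambda>n. Z n \<omega>) at_top sequentially"
proof -
  have [measurable]: "Z n \<in> borel_measurable M" for n using assms(1) by auto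
  have "(\<integral>\<^sup>+\<omega>. liminf (\<lambda>n. ennreal (Z n \<omega>)) \<partial>M) \<noteq> \<infinity>"
    using nn_integral_liminf_le_bound[of M Z C] assms by (auto simp: top_unique)
  then have "AE \<omega> in M. liminf (\<lambda>n. ennreal (Z n \<omega>)) \<noteq> \<infinity>"
    by (intro nn_integral_PInf_AE) auto
  then show ?thesis
  proof eventually_elim
    case (elim \<omega>)
    show ?case
    proof
      assume "filterlim (\<lambda>n. Z n \<omega>) at_top sequentially"
      then have "(\<lambda>n. ennreal (Z n \<omega>)) \<longlonglongrightarrow> \<infinity>"
        by (simp add: ennreal_tendsto_top_eq_at_top)
      with elim show False using lim_imp_Liminf[of sequentially] by auto
    qed
  qed
qed

section \<open>Submartingales and their truncations\<close>

locale right_continuous_submartingale = filtered_prob_space +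
  fixes X :: "real \<Rightarrow> 'a \<Rightarrow> real"
  assumes submartingale: "integrable_submartingale M F X"
    and right_continuous: "right_continuous_process M X"
begin

lemma adapted: "X r \<in> borel_measurable (F r)"
  using submartingale by (simp add: integrable_submartingale_def)

lemma integrable_X [simp]: "integrable M (X r)"
  using submartingale by (simp add: integrable_submartingale_def)

lemma measurable_X [measurable]: "X r \<in> borel_measurable M"
  using integrable_X by (rule borel_measurable_integrable)

lemma subalgebra_mono: "s \<le> t \<Longrightarrow> subalgebra (F t) (F s)"
  by (simp add: subalgebra_def space_F sets_F_mono)

lemma sets_F_subset: "A \<in> sets (F s) \<Longrightarrow> A \<in> sets M"
  using subalgebra_F[of s] by (auto simp: subalgebra_def)

text \<open>Integrating over \<open>A\<close> removes the conditional expectation; the later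
  arguments use the submartingale inequality in this form.\<close>

lemma set_integral_mono_time:
  assumes "s \<le> t" "A \<in> sets (F s)"
  shows "(\<integral>\<omega>\<in>A. X s \<omega> \<partial>M) \<le> (\<integral>\<omega>\<in>A. X t \<omega> \<partial>M)"
proof -
  interpret S: finite_measure_subalgebra M "F s"
    by unfold_locales (rule subalgebra_F)
  have A: "A \<in> sets M" by (rule sets_F_subset[OF assms(2)])
  have "(\<integral>\<omega>\<in>A. X s \<omega> \<partial>M) \<le> (\<integral>\<omega>\<in>A. real_cond_exp M (F s) (X t) \<omega> \<partial>M)"
    unfolding set_lebesgue_integral_def
  proof (rule integral_mono_AE)
    show "integrable M (\<lambda>\<omega>. indicator A \<omega> *\<^sub>R X s \<omega>)"
         "integrable M (\<lambda>\<omega>. indicator A \<omega> *\<^sub>R real_cond_exp M (F s) (X t) \<omega>)"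
      by (intro integrable_mult_indicator A integrable_X S.real_cond_exp_int(1))+
    have "AE \<omega> in M. X s \<omega> \<le> real_cond_exp M (F s) (X t) \<omega>"
      using submartingale assms(1) by (simp add: integrable_submartingale_def)
    then show "AE \<omega> in M. indicator A \<omega> *\<^sub>R X s \<omega>
        \<le> indicator A \<omega> *\<^sub>R real_cond_exp M (F s) (X t) \<omega>"
      by eventually_elim (simp add: indicator_def)
  qed
  also have "\<dots> = (\<integral>\<omega>\<in>A. X t \<omega> \<partial>M)"
    by (rule S.real_cond_exp_intA[symmetric, OF integrable_X assms(2)])
  finally show ?thesis .
qed

definition excess :: "real \<Rightarrow> real \<Rightarrow> 'a \<Rightarrow> real" where
  "excess a r \<omega> = max 0 (X r \<omega> - a)"

lemma integrable_excess [simp]: "integrable M (excess a r)"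
  unfolding excess_def by (intro integrable_max) auto

lemma excess_nonneg [simp]: "0 \<le> excess a r \<omega>"
  by (simp add: excess_def)

lemma integrable_excess_on [simp]:
  "A \<in> sets M \<Longrightarrow> integrable M (\<lambda>\<omega>. indicator A \<omega> * excess a r \<omega>)"
  using integrable_mult_indicator[of A M "excess a r"] by simp

text \<open>The truncation is again a submartingale, shown without Jensen: \<open>B\<close>, the
  part of \<open>A\<close> where \<open>X s > a\<close>, lies in \<open>F s\<close>. On
  \<open>B\<close> the excess at \<open>s\<close> is \<open>X s - a\<close>, and the excess at
  \<open>t\<close> dominates \<open>X t - a\<close>; on the rest of \<open>A\<close> the excess at
  \<open>s\<close> vanishes.\<close>

lemma integral_excess_mono:
  assumes "s \<le> t" "A \<in> sets (F s)"
  shows "(\<integral>\<omega>. indicator A \<omega> * excess a s \<omega> \<partial>M) \<le> (\<integral>\<omega>. indicator A \<omega> * excess a t \<omega> \<partial>M)"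
proof -
  define B where "B = A \<inter> {\<omega> \<in> space (F s). a < X s \<omega>}"
  have BF: "B \<in> sets (F s)"
    unfolding B_def using assms(2) adapted[of s] by measurable
  have B [measurable]: "B \<in> sets M" and A [measurable]: "A \<in> sets M"
    using BF assms(2) sets_F_subset by auto
  have intB: "integrable M (\<lambda>\<omega>. indicator B \<omega> * X r \<omega>)" for r
    using integrable_mult_indicator[OF B integrable_X] by simp
  have "(\<integral>\<omega>. indicator A \<omega> * excess a s \<omega> \<partial>M) = (\<integral>\<omega>. indicator B \<omega> * X s \<omega> - indicator B \<omega> * a \<partial>M)"
    by (intro Bochner_Integration.integral_cong)
       (auto simp: B_def excess_def indicator_def space_F)
  also have "\<dots> = (\<integral>\<omega>. indicator B \<omega> * X s \<omega> \<partial>M) - (\<integral>\<omega>. indicator B \<omega> * a \<partial>M)"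
    by (intro Bochner_Integration.integral_diff intB) (auto simp: emeasure_eq_measure)
  also have "\<dots> \<le> (\<integral>\<omega>. indicator B \<omega> * X t \<omega> \<partial>M) - (\<integral>\<omega>. indicator B \<omega> * a \<partial>M)"
    using set_integral_mono_time[OF assms(1) BF] by (simp add: set_lebesgue_integral_def)
  also have "\<dots> = (\<integral>\<omega>. indicator B \<omega> * X t \<omega> - indicator B \<omega> * a \<partial>M)"
    by (intro Bochner_Integration.integral_diff[symmetric] intB) (auto simp: emeasure_eq_measure)
  also have "\<dots> \<le> (\<integral>\<omega>. indicator A \<omega> * excess a t \<omega> \<partial>M)"
  proof (rule integral_mono)
    show "integrable M (\<lambda>\<omega>. indicator B \<omega> * X t \<omega> - indicator B \<omega> * a)"
      by (intro Bochner_Integration.integrable_diff intB) (auto simp: emeasure_eq_measure)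
    show "integrable M (\<lambda>\<omega>. indicator A \<omega> * excess a t \<omega>)"
      by simp
  qed (auto simp: B_def excess_def indicator_def)
  finally show ?thesis .
qed

lemma expectation_excess_mono: "s \<le> t \<Longrightarrow> expectation (excess a s) \<le> expectation (excess a t)"
  using integral_excess_mono[of s t "space M" a] sets.top[of "F s"]
  by (simp add: space_F cong: Bochner_Integration.integral_cong)

section \<open>Doob's upcrossing inequality\<close>

definition idle :: "real \<Rightarrow> real \<Rightarrow> (nat \<Rightarrow> real) \<Rightarrow> nat \<Rightarrow> 'a set" where
  "idle a b T n = {\<omega> \<in> space M. \<not> climbing a b (\<lambda>i. X (T i) \<omega>) n}"

text \<open>The state is updated from the previous state, measurable for the larger algebra because
  \<open>T\<close> is monotone, and from the newly observed value.\<close>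

lemma pred_climbing:
  assumes "mono T"
  shows "Measurable.pred (F (T n)) (\<lambda>\<omega>. climbing a b (\<lambda>i. X (T i) \<omega>) n)"
proof (induction n)
  case 0
  have [measurable]: "X (T 0) \<in> borel_measurable (F (T 0))" by (rule adapted)
  show ?case by simp
next
  case (Suc n)
  have [measurable]: "X (T (Suc n)) \<in> borel_measurable (F (T (Suc n)))" by (rule adapted)
  have [measurable]: "Measurable.pred (F (T (Suc n))) (\<lambda>\<omega>. climbing a b (\<lambda>i. X (T i) \<omega>) n)"
    by (rule measurable_from_subalg[OF subalgebra_mono Suc]) (simp add: monoD[OF assms])
  show ?case by simp
qed

lemma idle_sets_F: "mono T \<Longrightarrow> idle a b T n \<in> sets (F (T n))"
  using pred_climbing[where T = T and n = n and a = a and b = b] unfolding idle_def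
  by (simp add: pred_def space_F[symmetric, of "T n"] sets.sets_Collect_neg)

lemma idle_sets [measurable]: "mono T \<Longrightarrow> idle a b T n \<in> sets M"
  using idle_sets_F sets_F_subset by blast

lemma integrable_upcrossings [simp]:
  assumes "mono T"
  shows "integrable M (\<lambda>\<omega>. real (upcrossings a b (\<lambda>i. X (T i) \<omega>) n))"
proof (rule integrable_const_bound)
  have [measurable]: "Measurable.pred M (\<lambda>\<omega>. climbing a b (\<lambda>i. X (T i) \<omega>) n)" for n
    by (rule measurable_from_subalg[OF subalgebra_F pred_climbing[OF assms]])
  have "(\<lambda>\<omega>. upcrossings a b (\<lambda>i. X (T i) \<omega>) n) \<in> measurable M (count_space UNIV)"
    by (induction n) (simp_all add: of_bool_def)
  then show "(\<lambda>\<omega>. real (upcrossings a b (\<lambda>i. X (T i) \<omega>) n)) \<in> borel_measurable M"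
    by simp
  show "AE \<omega> in M. norm (real (upcrossings a b (\<lambda>i. X (T i) \<omega>) n)) \<le> real n"
    using upcrossings_le by simp
qed

text \<open>The potential \<open>(b - a) * upcrossings - indicator idle * excess\<close> has nonincreasing expectation:
  it stays constant or drops during a climb, and while idle it changes by minus the increment of the
  submartingale \<open>excess a\<close>.\<close>
lemma upcrossing_inequality_idle:
  assumes "mono T" "a < b"
  shows "(b - a) * expectation (\<lambda>\<omega>. upcrossings a b (\<lambda>i. X (T i) \<omega>) n)
    \<le> (\<integral>\<omega>. indicator (idle a b T n) \<omega> * excess a (T n) \<omega> \<partial>M)"
proof (induction n)
  case (Suc n)
  let ?U = "\<lambda>n \<omega>. real (upcrossings a b (\<lambda>i. X (T i) \<omega>) n)"
  let ?I = "\<lambda>n \<omega>. indicator (idle a b T n) \<omega> :: real"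
  let ?Y = "excess a (T (Suc n))"
  have "(b - a) * expectation (?U (Suc n)) - (\<integral>\<omega>. ?I (Suc n) \<omega> * ?Y \<omega> \<partial>M)
      = (\<integral>\<omega>. (b - a) * ?U (Suc n) \<omega> - ?I (Suc n) \<omega> * ?Y \<omega> \<partial>M)"
    using assms by (subst Bochner_Integration.integral_diff)
      (auto simp del: upcrossings.simps intro!: integrable_upcrossings integrable_excess_on idle_sets)
  \<comment> \<open>Both sides use the excess at the later time. Completing a climb adds
    \<open>b - a\<close> but subtracts \<open>?Y\<close>, which is then at least
    \<open>b - a\<close>; starting one needs \<open>?Y = 0\<close>. If the state does not change,
    equality holds.\<close>
  also have "\<dots> \<le> (\<integral>\<omega>. (b - a) * ?U n \<omega> - ?I n \<omega> * ?Y \<omega> \<partial>M)"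
  proof (rule integral_mono)
    fix \<omega> assume "\<omega> \<in> space M"
    then show "(b - a) * ?U (Suc n) \<omega> - ?I (Suc n) \<omega> * ?Y \<omega> \<le> (b - a) * ?U n \<omega> - ?I n \<omega> * ?Y \<omega>"
      using assms(2) by (auto simp: idle_def indicator_def excess_def algebra_simps)
  qed (use assms in \<open>auto simp del: upcrossings.simps intro!: integrable_upcrossings
      integrable_excess_on idle_sets Bochner_Integration.integrable_diff\<close>)
  also have "\<dots> = (b - a) * expectation (?U n) - (\<integral>\<omega>. ?I n \<omega> * ?Y \<omega> \<partial>M)"
    using assms by (subst Bochner_Integration.integral_diff)
      (auto intro!: integrable_upcrossings integrable_excess_on idle_sets)
  \<comment> \<open>Being idle at \<open>n\<close> is an event of \<open>F (T n)\<close>, so on it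
    the mean excess at \<open>T n\<close> is at most that at \<open>T (Suc n)\<close>; the induction
    hypothesis bounds the former from below.\<close>
  also have "\<dots> \<le> 0"
  proof -
    have "T n \<le> T (Suc n)" using assms(1) by (simp add: monoD)
    from integral_excess_mono[OF this idle_sets_F[OF assms(1)]] Suc show ?thesis
      by (meson diff_le_0_iff_le order_trans)
  qed
  finally show ?case by simp
qed (simp add: integral_nonneg)

lemma upcrossing_inequality:
  assumes "mono T" "a < b"
  shows "(b - a) * expectation (\<lambda>\<omega>. upcrossings a b (\<lambda>i. X (T i) \<omega>) n)
    \<le> expectation (excess a (T n))"
proof -
  have "(\<integral>\<omega>. indicator (idle a b T n) \<omega> * excess a (T n) \<omega> \<partial>M) \<le> expectation (excess a (T n))"
    by (intro integral_mono integrable_excess_on idle_sets assms(1) integrable_excess)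
       (simp add: indicator_def)
  then show ?thesis using upcrossing_inequality_idle[OF assms, of n] by linarith
qed

section \<open>Almost sure absence of oscillation\<close>

text \<open>The expected counts are bounded by \<open>C / (b - a)\<close> uniformly in
  \<open>n\<close>. The last index \<open>K n\<close> is left free to treat both ends of the time
  axis.\<close>

lemma AE_upcrossings_not_at_top:
  assumes "a < b" "\<And>n. expectation (excess a (grid n (K n))) \<le> C"
  shows "AE \<omega> in M. \<not> filterlim (\<lambda>n. upcrossings a b (\<lambda>i. X (grid n i) \<omega>) (K n)) at_top sequentially"
proof -
  have "expectation (\<lambda>\<omega>. upcrossings a b (\<lambda>i. X (grid n i) \<omega>) (K n)) \<le> C / (b - a)" for n
    using upcrossing_inequality[OF mono_grid assms(1), of n "K n"] assms(1) assms(2)[of n]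
    by (simp add: field_simps)
  then have "AE \<omega> in M. \<not> filterlim (\<lambda>n. real (upcrossings a b (\<lambda>i. X (grid n i) \<omega>) (K n)))
      at_top sequentially"
    by (intro AE_not_filterlim_at_top) (auto simp: mono_grid)
  then show ?thesis
    by eventually_elim (use filterlim_compose[OF filterlim_real_sequentially] in blast)
qed

lemma AE_no_oscillation_at_top:
  assumes "a < b" "\<And>r. 0 \<le> r \<Longrightarrow> expectation (excess a r) \<le> C"
  shows "AE \<omega> in M. \<not> (frequently (\<lambda>r. X r \<omega> < a) at_top \<and> frequently (\<lambda>r. b < X r \<omega>) at_top)"
proof -
  have "AE \<omega> in M. \<not> filterlim
      (\<lambda>n. upcrossings a b (\<lambda>i. X (grid n i) \<omega>) (grid_index n (real n))) at_top sequentially"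
    by (rule AE_upcrossings_not_at_top[OF assms(1)])
       (rule assms(2), simp add: grid_grid_index_nat)
  with AE_space show ?thesis
  proof eventually_elim
    case (elim \<omega>)
    then show ?case
      using filterlim_upcrossings_at_top[of "\<lambda>r. X r \<omega>" a b] right_continuous assms(1)
      by (auto simp: right_continuous_process_def)
  qed
qed

lemma AE_no_oscillation_at_bot:
  assumes "a < b"
  shows "AE \<omega> in M. \<not> (frequently (\<lambda>r. X r \<omega> < a) at_bot \<and> frequently (\<lambda>r. b < X r \<omega>) at_bot)"
proof -
  \<comment> \<open>All grids stop by time 1, so the mean excess at time 1 serves as the uniform
    bound.\<close>
  have "grid n (grid_index n 0) \<le> 1" for n
    using grid_grid_index_nat[of n 0] by simp
  then have "AE \<omega> in M. \<not> filterlim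
      (\<lambda>n. upcrossings a b (\<lambda>i. X (grid n i) \<omega>) (grid_index n 0)) at_top sequentially"
    by (intro AE_upcrossings_not_at_top[OF assms, where C = "expectation (excess a 1)"]
        expectation_excess_mono)
  with AE_space show ?thesis
  proof eventually_elim
    case (elim \<omega>)
    then show ?case
      using filterlim_upcrossings_at_bot[of "\<lambda>r. X r \<omega>" a b] right_continuous assms(1)
      by (auto simp: right_continuous_process_def)
  qed
qed

text \<open>A countable union over rational pairs yields one null set outside which no oscillation
  occurs.\<close>

lemma AE_ereal_convergent:
  assumes "L \<noteq> bot"
    and "\<And>a b. a < b \<Longrightarrow>
      AE \<omega> in M. \<not> (frequently (\<lambda>r. X r \<omega> < a) L \<and> frequently (\<lambda>r. b < X r \<omega>) L)"
  shows "AE \<omega> in M. \<exists>l. ((\<lambda>r. ereal (X r \<omega>)) \<longlongrightarrow> l) L"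
proof -
  have "AE \<omega> in M. \<forall>a\<in>\<rat>. \<forall>b\<in>\<rat>. a < b \<longrightarrow>
      \<not> (frequently (\<lambda>r. X r \<omega> < a) L \<and> frequently (\<lambda>r. b < X r \<omega>) L)"
    using assms(2) by (intro AE_ball_countable' countable_rat AE_impI)
  then show ?thesis
    by eventually_elim (rule ereal_convergent_if_no_oscillation[OF assms(1)], auto)
qed

section \<open>Almost sure limits at both ends\<close>

text \<open>The positive parts at negative times have mean at most that at time 0, which rules out
  the limit \<open>\<infinity>\<close> along the times \<open>- real n\<close>.\<close>

lemma convergence_at_bot:
  "AE \<omega> in M. \<exists>l<\<infinity>. ((\<lambda>r. ereal (X r \<omega>)) \<longlongrightarrow> l) at_bot"
proof -
  have "AE \<omega> in M. \<not> filterlim (\<lambda>n. excess 0 (- real n) \<omega>) at_top sequentially"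
    by (rule AE_not_filterlim_at_top[where C = "expectation (excess 0 0)"])
       (auto intro: expectation_excess_mono)
  moreover have "AE \<omega> in M. \<exists>l. ((\<lambda>r. ereal (X r \<omega>)) \<longlongrightarrow> l) at_bot"
    by (intro AE_ereal_convergent AE_no_oscillation_at_bot) simp
  ultimately show ?thesis
  proof eventually_elim
    case (elim \<omega>)
    then obtain l where l: "((\<lambda>r. ereal (X r \<omega>)) \<longlongrightarrow> l) at_bot" by blast
    have "l \<noteq> \<infinity>"
    proof
      assume "l = \<infinity>"
      then have "filterlim (\<lambda>r. X r \<omega>) at_top at_bot"
        using l by (simp add: tendsto_PInfty_eq_at_top)
      then have "filterlim (\<lambda>n. X (- real n) \<omega>) at_top sequentially"
        by (rule filterlim_compose)
           (intro filterlim_compose[OF filterlim_uminus_at_bot_at_top] filterlim_real_sequentially)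
      then have "filterlim (\<lambda>n. excess 0 (- real n) \<omega>) at_top sequentially"
        by (rule filterlim_at_top_mono) (simp add: excess_def)
      with elim show False by blast
    qed
    with l show ?case by (intro exI[of _ l]) (simp add: less_top[symmetric] top_ereal_def)
  qed
qed

lemma convergence_at_top:
  assumes bound: "\<And>r. 0 \<le> r \<Longrightarrow> expectation (\<lambda>\<omega>. \<bar>X r \<omega>\<bar>) \<le> C"
  shows "\<exists>Y. integrable M Y \<and> (AE \<omega> in M. ((\<lambda>r. X r \<omega>) \<longlongrightarrow> Y \<omega>) at_top)"
proof -
  have "expectation (excess a r) \<le> C + \<bar>a\<bar>" if "0 \<le> r" for a r
  proof -
    have "expectation (excess a r) \<le> expectation (\<lambda>\<omega>. \<bar>X r \<omega>\<bar> + \<bar>a\<bar>)"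
      by (intro integral_mono) (auto simp: excess_def)
    also have "\<dots> = expectation (\<lambda>\<omega>. \<bar>X r \<omega>\<bar>) + \<bar>a\<bar>"
      by (subst Bochner_Integration.integral_add) (auto simp: prob_space)
    finally show ?thesis using bound[OF that] by linarith
  qed
  then have "AE \<omega> in M. \<exists>l. ((\<lambda>r. ereal (X r \<omega>)) \<longlongrightarrow> l) at_top"
    by (intro AE_ereal_convergent AE_no_oscillation_at_top) auto
  \<comment> \<open>The absolute value excludes both infinite limits at once.\<close>
  moreover have "AE \<omega> in M. \<not> filterlim (\<lambda>n. \<bar>X (real n) \<omega>\<bar>) at_top sequentially"
    by (rule AE_not_filterlim_at_top[where C = C]) (auto intro: bound)
  ultimately have conv: "AE \<omega> in M. \<exists>l. ((\<lambda>r. X r \<omega>) \<longlongrightarrow> l) at_top"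
  proof eventually_elim
    case (elim \<omega>)
    then obtain l where l: "((\<lambda>r. ereal (X r \<omega>)) \<longlongrightarrow> l) at_top" by blast
    then have ln: "(\<lambda>n. ereal (X (real n) \<omega>)) \<longlonglongrightarrow> l"
      by (rule filterlim_compose) (rule filterlim_real_sequentially)
    have "\<bar>l\<bar> \<noteq> \<infinity>"
    proof
      assume inf: "\<bar>l\<bar> = \<infinity>"
      have "(\<lambda>n. \<bar>ereal (X (real n) \<omega>)\<bar>) \<longlonglongrightarrow> \<bar>l\<bar>"
        by (intro tendsto_intros ln)
      then have "filterlim (\<lambda>n. \<bar>X (real n) \<omega>\<bar>) at_top sequentially"
        by (simp add: inf tendsto_PInfty_eq_at_top)
      with elim show False by blast
    qed
    then obtain x where "l = ereal x" by auto
    with l show ?case by auto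
  qed
  \<comment> \<open>A limit along the integers, so that \<open>Y\<close> is measurable on the whole
    space, whatever \<open>lim\<close> returns where there is no convergence.\<close>
  define Y where "Y \<omega> = lim (\<lambda>n. X (real n) \<omega>)" for \<omega>
  have [measurable]: "Y \<in> borel_measurable M" unfolding Y_def by measurable
  have seq: "((\<lambda>n. X (real n) \<omega>) \<longlonglongrightarrow> l)" if "((\<lambda>r. X r \<omega>) \<longlongrightarrow> l) at_top" for \<omega> l
    using that by (rule filterlim_compose) (rule filterlim_real_sequentially)
  have Y: "AE \<omega> in M. ((\<lambda>r. X r \<omega>) \<longlongrightarrow> Y \<omega>) at_top"
    using conv by eventually_elim (use seq limI in \<open>force simp: Y_def\<close>)
  \<comment> \<open>Prepares Fatou, which transfers the bound \<open>C\<close> to the mean of the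
    absolute value of \<open>Y\<close>.\<close>
  have "AE \<omega> in M. ennreal (norm (Y \<omega>)) = liminf (\<lambda>n. ennreal \<bar>X (real n) \<omega>\<bar>)"
    using Y
  proof eventually_elim
    case (elim \<omega>)
    have "(\<lambda>n. ennreal \<bar>X (real n) \<omega>\<bar>) \<longlonglongrightarrow> ennreal \<bar>Y \<omega>\<bar>"
      by (intro tendsto_intros seq elim)
    then have "liminf (\<lambda>n. ennreal \<bar>X (real n) \<omega>\<bar>) = ennreal \<bar>Y \<omega>\<bar>"
      by (rule lim_imp_Liminf[OF sequentially_bot])
    then show ?case by simp
  qed
  then have "(\<integral>\<^sup>+\<omega>. ennreal (norm (Y \<omega>)) \<partial>M) = (\<integral>\<^sup>+\<omega>. liminf (\<lambda>n. ennreal \<bar>X (real n) \<omega>\<bar>) \<partial>M)"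
    by (rule nn_integral_cong_AE)
  also have "\<dots> \<le> ennreal C"
    by (rule nn_integral_liminf_le_bound) (auto intro: bound)
  finally have "integrable M Y"
    by (intro integrableI_bounded) (auto intro: le_less_trans)
  with Y show ?thesis by blast
qed

end

theorem theorem1p1:
  fixes M :: "'a measure"
    and F :: "real \<Rightarrow> 'a measure"
    and X :: "real \<Rightarrow> 'a \<Rightarrow> real"
  assumes "filtered_prob_space M F"
    and "integrable_submartingale M F X"
    and "right_continuous_process M X"
  shows "((SUP r\<in>{0..}. ereal (integral\<^sup>L M (\<lambda>\<omega>. \<bar>X r \<omega>\<bar>))) < \<infinity> \<longrightarrow>
            (\<exists>Y :: 'a \<Rightarrow> real. integrable M Y \<and>
               (AE \<omega> in M. ((\<lambda>r. X r \<omega>) \<longlongrightarrow> Y \<omega>) at_top)))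
       \<and> (AE \<omega> in M. \<exists>l :: ereal. l < \<infinity> \<and> ((\<lambda>r. ereal (X r \<omega>)) \<longlongrightarrow> l) at_bot)"
proof -
  interpret right_continuous_submartingale M F X
    using assms by (simp add: right_continuous_submartingale_def right_continuous_submartingale_axioms_def)
  have "\<exists>Y. integrable M Y \<and> (AE \<omega> in M. ((\<lambda>r. X r \<omega>) \<longlongrightarrow> Y \<omega>) at_top)"
    if "(SUP r\<in>{0..}. ereal (expectation (\<lambda>\<omega>. \<bar>X r \<omega>\<bar>))) < \<infinity>"
  proof -
    from that obtain C where C: "(SUP r\<in>{0..}. ereal (expectation (\<lambda>\<omega>. \<bar>X r \<omega>\<bar>))) < ereal C"
      using ereal_dense2 by blast
    have "expectation (\<lambda>\<omega>. \<bar>X r \<omega>\<bar>) \<le> C" if "0 \<le> r" for r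
      using less_imp_le[OF SUP_lessD[OF C, of r]] that by simp
    then show ?thesis by (rule convergence_at_top)
  qed
  then show ?thesis using convergence_at_bot by blast
qed

end
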